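(* Let $k$ be a real number with $9k^2>8$, let $\lambda_1=\frac{3k+\sqrt{9k^2-8}}{2}$, $\lambda_2=\frac{3k-\sqrt{9k^2-8}}{2}$, and let $\alpha=\sum_{r=0}^{7}\lambda_1^{r}e_r$, $\beta=\sum_{r=0}^{7}\lambda_2^{r}e_r$ in $\mathbb{O}$. Then for all nonnegative integers $n,i,j$: $$M\mathbb{O}_{k,n+i}M\mathbb{O}_{k,n+j}-M\mathbb{O}_{k,n}M\mathbb{O}_{k,n+i+j}=\frac{2^{n}M_{k,i}\left[\beta\alpha\lambda_1^{j}-\alpha\beta\lambda_2^{j}\right]}{\sqrt{9k^2-8}}.$$
   Context: $\mathbb{O}$ denotes the octonions, the $8$-dimensional real (non-commutative, non-associative) algebra with basis $e_0=1,e_1,\dots,e_7$ and bilinear multiplication determined by: $e_0$ is the identity, $e_a^2=-1$ for $a\ge1$, $e_ae_b=-e_be_a$ for distinct $a,b\ge1$, and $e_ae_b=e_c$, $e_be_c=e_a$, $e_ce_a=e_b$ for $(a,b,c)\in\{(1,2,3),(1,4,5),(1,7,6),(2,4,6),(2,5,7),(3,4,7),(3,6,5)\}$. The $k$-Mersenne numbers are defined by $M_{k,0}=0$, $M_{k,1}=1$, $M_{k,n+1}=3kM_{k,n}-2M_{k,n-1}$ for $n\ge1$. The $n$-th $k$-Mersenne octonion is $M\mathbb{O}_{k,n}=\sum_{r=0}^{7}M_{k,n+r}e_r$ for $n\ge 0$. *)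

theory Defs
  imports Complex_Main
begin

text \<open>
  An octonion is given by its eight real coordinates with respect to the basis
  e_0, ..., e_7, stored as a function on the natural numbers vanishing from index 8 on.
\<close>

typedef octonion = "{f :: nat \<Rightarrow> real. \<forall>r\<ge>8. f r = 0}"
  morphisms coord Abs_octonion
  by (rule exI[of _ "\<lambda>_. 0"]) simp

setup_lifting type_definition_octonion

lemma coord_ge_8 [simp]: "8 \<le> r \<Longrightarrow> coord x r = 0"
  using coord[of x] by simp

lemma octonion_eqI: "(\<And>r. r < 8 \<Longrightarrow> coord x r = coord y r) \<Longrightarrow> x = y"
  by (metis coord_ge_8 coord_inject ext not_le)

instantiation octonion :: real_vector
begin

lift_definition zero_octonion :: octonion is "\<lambda>_. 0" by simp
lift_definition plus_octonion :: "octonion \<Rightarrow> octonion \<Rightarrow> octonion" is "\<lambda>x y r. x r + y r" by simp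
lift_definition minus_octonion :: "octonion \<Rightarrow> octonion \<Rightarrow> octonion" is "\<lambda>x y r. x r - y r" by simp
lift_definition uminus_octonion :: "octonion \<Rightarrow> octonion" is "\<lambda>x r. - x r" by simp
lift_definition scaleR_octonion :: "real \<Rightarrow> octonion \<Rightarrow> octonion" is "\<lambda>c x r. c * x r" by simp

instance
proof
  fix x y z :: octonion and a b :: real
  show "x + y + z = x + (y + z)" by transfer (simp add: add.assoc)
  show "x + y = y + x" by transfer (simp add: add.commute)
  show "0 + x = x" by transfer simp
  show "- x + x = 0" by transfer simp
  show "x - y = x + - y" by transfer simp
  show "a *\<^sub>R (x + y) = a *\<^sub>R x + a *\<^sub>R y" by transfer (simp add: distrib_left)
  show "(a + b) *\<^sub>R x = a *\<^sub>R x + b *\<^sub>R x" by transfer (simp add: distrib_right)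
  show "a *\<^sub>R b *\<^sub>R x = (a * b) *\<^sub>R x" by transfer (simp add: mult.assoc)
  show "1 *\<^sub>R x = x" by transfer simp
qed

end

lemma coord_zero [simp]: "coord 0 r = 0" by transfer simp
lemma coord_add [simp]: "coord (x + y) r = coord x r + coord y r" by transfer simp
lemma coord_diff [simp]: "coord (x - y) r = coord x r - coord y r" by transfer simp
lemma coord_minus [simp]: "coord (- x) r = - coord x r" by transfer simp
lemma coord_scaleR [simp]: "coord (c *\<^sub>R x) r = c * coord x r" by transfer simp
lemma coord_sum [simp]: "coord (sum f A) r = (\<Sum>a\<in>A. coord (f a) r)"
  by (induction A rule: infinite_finite_induct) auto

lift_definition oct_basis :: "nat \<Rightarrow> octonion" is "\<lambda>r s. if s = r \<and> r < 8 then 1 else 0"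
  by simp

lemma coord_basis [simp]: "coord (oct_basis r) s = (if s = r \<and> r < 8 then 1 else 0)"
  by transfer simp

definition oct_triples :: "(nat \<times> nat \<times> nat) set" where
  "oct_triples = {(1,2,3), (1,4,5), (1,7,6), (2,4,6), (2,5,7), (3,4,7), (3,6,5)}"

definition oct_cyclic :: "nat \<Rightarrow> nat \<Rightarrow> nat \<Rightarrow> bool" where
  "oct_cyclic a b c \<longleftrightarrow>
     (a, b, c) \<in> oct_triples \<or> (b, c, a) \<in> oct_triples \<or> (c, a, b) \<in> oct_triples"

text \<open>
  The product of two basis elements. For distinct nonzero a and b exactly one summand of
  the last line is nonzero, since every such pair lies in exactly one triple.
\<close>

definition oct_basis_mult :: "nat \<Rightarrow> nat \<Rightarrow> octonion" where
  "oct_basis_mult a b =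
     (if a = 0 then oct_basis b
      else if b = 0 then oct_basis a
      else if a = b then - oct_basis 0
      else (\<Sum>c<8. if oct_cyclic a b c then oct_basis c
                   else if oct_cyclic b a c then - oct_basis c
                   else 0))"

instantiation octonion :: "{one, times}"
begin

definition one_octonion :: octonion where "one_octonion = oct_basis 0"

definition times_octonion :: "octonion \<Rightarrow> octonion \<Rightarrow> octonion" where
  "x * y = (\<Sum>a<8. \<Sum>b<8. (coord x a * coord y b) *\<^sub>R oct_basis_mult a b)"

instance ..

end

text \<open>
  The multiplication is bilinear and obeys the rules that characterise the octonion product.
\<close>

lemma octonion_expand: "x = (\<Sum>r<8. coord x r *\<^sub>R oct_basis r)"
proof (rule octonion_eqI)
  fix s :: nat assume "s < 8"
  then show "coord x s = coord (\<Sum>r<8. coord x r *\<^sub>R oct_basis r) s"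
    by (simp add: if_distrib [of "(*) _"] sum.delta cong: if_cong)
qed

lemma oct_mult_linear:
  fixes x y z :: octonion
  shows "(x + y) * z = x * z + y * z"
    and "x * (y + z) = x * y + x * z"
    and "(c *\<^sub>R x) * y = c *\<^sub>R (x * y)"
    and "x * (c *\<^sub>R y) = c *\<^sub>R (x * y)"
  by (rule octonion_eqI; simp add: times_octonion_def algebra_simps sum.distrib sum_distrib_left)+

lemma oct_basis_times:
  assumes "a < 8" "b < 8"
  shows "oct_basis a * oct_basis b = oct_basis_mult a b"
proof -
  have "oct_basis a * oct_basis b =
      (\<Sum>a'<8. \<Sum>b'<8. if b' = b then (if a' = a then oct_basis_mult a' b' else 0) else 0)"
    unfolding times_octonion_def using assms by (intro sum.cong refl) auto
  also have "\<dots> = oct_basis_mult a b"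
    using assms by (simp add: sum.delta)
  finally show ?thesis .
qed

lemma oct_mult_one:
  fixes x :: octonion
  shows "1 * x = x" and "x * 1 = x"
proof -
  have "1 * x = (\<Sum>a<8. \<Sum>b<8. if a = (0::nat) then coord x b *\<^sub>R oct_basis b else 0)"
    unfolding times_octonion_def one_octonion_def
    by (intro sum.cong refl) (auto simp: oct_basis_mult_def)
  also have "\<dots> = (\<Sum>b<8. \<Sum>a<8. if a = (0::nat) then coord x b *\<^sub>R oct_basis b else 0)"
    by (rule sum.swap)
  also have "\<dots> = x"
    by (simp add: sum.delta octonion_expand [symmetric])
  finally show "1 * x = x" .
  have "x * 1 = (\<Sum>a<8. \<Sum>b<8. if b = (0::nat) then coord x a *\<^sub>R oct_basis a else 0)"
    unfolding times_octonion_def one_octonion_def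
    by (intro sum.cong refl) (auto simp: oct_basis_mult_def)
  also have "\<dots> = x"
    by (simp add: sum.delta octonion_expand [symmetric])
  finally show "x * 1 = x" .
qed

lemma oct_basis_square: "a \<in> {1..7} \<Longrightarrow> oct_basis a * oct_basis a = - 1"
  by (simp add: oct_basis_times oct_basis_mult_def one_octonion_def)

lemma lessThan_8: "{..<8::nat} = {0,1,2,3,4,5,6,7}"
  by auto

lemma oct_basis_triple:
  assumes "(a, b, c) \<in> oct_triples"
  shows "oct_basis a * oct_basis b = oct_basis c \<and> oct_basis b * oct_basis c = oct_basis a
           \<and> oct_basis c * oct_basis a = oct_basis b"
  using assms unfolding oct_triples_def
  by (elim insertE emptyE; simp add: oct_basis_times oct_basis_mult_def oct_cyclic_def
        oct_triples_def lessThan_8)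

lemma oct_basis_anticomm:
  assumes "a \<in> {1..7}" "b \<in> {1..7}" "a \<noteq> b"
  shows "oct_basis a * oct_basis b = - (oct_basis b * oct_basis a)"
proof -
  have "a \<in> {1,2,3,4,5,6,7}" "b \<in> {1,2,3,4,5,6,7}" using assms by auto
  then show ?thesis using assms(3)
    by (auto simp: oct_basis_times oct_basis_mult_def oct_cyclic_def oct_triples_def
          lessThan_8)
qed

fun mersenne :: "real \<Rightarrow> nat \<Rightarrow> real" where
  "mersenne k 0 = 0"
| "mersenne k (Suc 0) = 1"
| "mersenne k (Suc (Suc n)) = 3 * k * mersenne k (Suc n) - 2 * mersenne k n"

definition mersenne_oct :: "real \<Rightarrow> nat \<Rightarrow> octonion" where
  "mersenne_oct k n = (\<Sum>r\<le>7. mersenne k (n + r) *\<^sub>R oct_basis r)"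

end

theory Submission
  imports Defs
begin

text \<open>
  The identity is Vajda's identity for a second-order recurrence, with attention paid to the
  order of the factors.  The numbers \<open>lambda1\<close> and \<open>lambda2\<close> are the roots of
  \<open>x\<^sup>2 = 3 k x - 2\<close>, and their difference is \<open>s = sqrt (9 k\<^sup>2 - 8) > 0\<close>.  Binet's formula
  \<open>s M\<^sub>n = lambda1\<^sup>n - lambda2\<^sup>n\<close> (\<open>mersenne_binet\<close>), applied in each coordinate, gives
  \<open>s MO\<^sub>n = lambda1\<^sup>n \<alpha> - lambda2\<^sup>n \<beta>\<close> (\<open>mersenne_oct_binet\<close>).

  Substitute this in the left-hand side, multiplied by \<open>s\<^sup>2\<close>, and expand by bilinearity.
  Both products have total index \<open>2 n + i + j\<close>, so the terms in \<open>\<alpha> * \<alpha>\<close> and \<open>\<beta> * \<beta>\<close> cancel.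
  The terms in \<open>\<alpha> * \<beta>\<close> and \<open>\<beta> * \<alpha>\<close>, which stay separate because the product is not
  commutative, have the common factor \<open>(lambda1 lambda2)\<^sup>n (lambda1\<^sup>i - lambda2\<^sup>i)\<close>
  (\<open>vajda_binet_form\<close>).  By \<open>lambda1 lambda2 = 2\<close> and Binet's formula once more, this factor is
  \<open>2\<^sup>n s M\<^sub>i\<close>, and dividing by \<open>s\<^sup>2\<close> leaves the factor \<open>1 / s\<close>.
\<close>

lemma oct_mult_diff:
  fixes x y z :: octonion
  shows "(x - y) * z = x * z - y * z"
    and "x * (y - z) = x * y - x * z"
proof -
  have minus: "u - v = u + (- 1) *\<^sub>R v" for u v :: octonion
    by simp
  show "(x - y) * z = x * z - y * z"
    unfolding minus by (simp only: oct_mult_linear)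
  show "x * (y - z) = x * y - x * z"
    unfolding minus by (simp only: oct_mult_linear)
qed

text \<open>
  In both products the indices add up to \<open>2 n + i + j\<close>, so \<open>x * x\<close> and \<open>y * y\<close> have the same
  coefficient in each and cancel; only the mixed products, kept in their two orders, survive.
\<close>

lemma vajda_binet_form:
  fixes a b :: real and x y :: octonion
  defines "X \<equiv> \<lambda>m. a ^ m *\<^sub>R x - b ^ m *\<^sub>R y"
  shows "X (n + i) * X (n + j) - X n * X (n + i + j)
         = ((a * b) ^ n * (a ^ i - b ^ i)) *\<^sub>R (a ^ j *\<^sub>R (y * x) - b ^ j *\<^sub>R (x * y))"
  unfolding X_def oct_mult_diff oct_mult_linear
  by (rule octonion_eqI) (simp add: power_add power_mult_distrib algebra_simps)

lemma mersenne_binet: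
  assumes "a\<^sup>2 = 3 * k * a - 2" and "b\<^sup>2 = 3 * k * b - 2"
  shows "(a - b) * mersenne k n = a ^ n - b ^ n"
proof (induction n rule: induct_nat_012)
  case (ge2 n)
  have "(a - b) * mersenne k (Suc (Suc n))
      = 3 * k * ((a - b) * mersenne k (Suc n)) - 2 * ((a - b) * mersenne k n)"
    by (simp add: algebra_simps)
  also have "\<dots> = 3 * k * (a ^ Suc n - b ^ Suc n) - 2 * (a ^ n - b ^ n)"
    by (simp only: ge2)
  also have "\<dots> = a ^ n * (3 * k * a - 2) - b ^ n * (3 * k * b - 2)"
    by (simp add: algebra_simps)
  also have "\<dots> = a ^ Suc (Suc n) - b ^ Suc (Suc n)"
    by (simp add: assms [symmetric] power2_eq_square)
  finally show ?case .
qed simp_all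

text \<open>
  The shift by \<open>r\<close> in the coordinate of \<open>oct_basis r\<close> turns into the factor \<open>a\<^sup>r\<close>; this is
  why the powers of the roots are the coordinates of \<open>\<alpha>\<close> and \<open>\<beta>\<close>.
\<close>

lemma mersenne_oct_binet:
  assumes "a\<^sup>2 = 3 * k * a - 2" and "b\<^sup>2 = 3 * k * b - 2"
  shows "(a - b) *\<^sub>R mersenne_oct k n
         = a ^ n *\<^sub>R (\<Sum>r\<le>7. a ^ r *\<^sub>R oct_basis r) - b ^ n *\<^sub>R (\<Sum>r\<le>7. b ^ r *\<^sub>R oct_basis r)"
  by (simp add: mersenne_oct_def scaleR_sum_right mersenne_binet [OF assms] power_add
      scaleR_left_diff_distrib sum_subtractf)

theorem theorem2p6:
  fixes k lambda1 lambda2 :: real and \<alpha> \<beta> :: octonion and n i j :: nat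
  assumes "9 * k\<^sup>2 > 8"
    and "lambda1 = (3 * k + sqrt (9 * k\<^sup>2 - 8)) / 2"
    and "lambda2 = (3 * k - sqrt (9 * k\<^sup>2 - 8)) / 2"
    and "\<alpha> = (\<Sum>r\<le>7. lambda1 ^ r *\<^sub>R oct_basis r)"
    and "\<beta> = (\<Sum>r\<le>7. lambda2 ^ r *\<^sub>R oct_basis r)"
  shows "mersenne_oct k (n + i) * mersenne_oct k (n + j)
           - mersenne_oct k n * mersenne_oct k (n + i + j)
         = ((2 ^ n * mersenne k i) *\<^sub>R (lambda1 ^ j *\<^sub>R (\<beta> * \<alpha>) - lambda2 ^ j *\<^sub>R (\<alpha> * \<beta>)))
             /\<^sub>R sqrt (9 * k\<^sup>2 - 8)"
proof -
  define s where "s = sqrt (9 * k\<^sup>2 - 8)"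
  have "s \<noteq> 0" and s_sq: "s\<^sup>2 = 9 * k\<^sup>2 - 8"
    using assms(1) by (simp_all add: s_def)
  have l1: "lambda1 = (3 * k + s) / 2" and l2: "lambda2 = (3 * k - s) / 2"
    using assms(2,3) by (simp_all add: s_def)
  have root1: "lambda1\<^sup>2 = 3 * k * lambda1 - 2" and root2: "lambda2\<^sup>2 = 3 * k * lambda2 - 2"
    and prod: "lambda1 * lambda2 = 2"
    using s_sq by (simp_all add: l1 l2 power2_eq_square field_simps)
  have diff: "lambda1 - lambda2 = s"
    by (simp add: l1 l2 field_simps)
  define MO where "MO = mersenne_oct k"
  have binet: "s *\<^sub>R MO m = lambda1 ^ m *\<^sub>R \<alpha> - lambda2 ^ m *\<^sub>R \<beta>" for m
    using mersenne_oct_binet [OF root1 root2, of m] by (simp add: diff assms(4,5) MO_def)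
  define R where "R = lambda1 ^ j *\<^sub>R (\<beta> * \<alpha>) - lambda2 ^ j *\<^sub>R (\<alpha> * \<beta>)"
  have "(s * s) *\<^sub>R (MO (n + i) * MO (n + j) - MO n * MO (n + i + j))
      = (s *\<^sub>R MO (n + i)) * (s *\<^sub>R MO (n + j)) - (s *\<^sub>R MO n) * (s *\<^sub>R MO (n + i + j))"
    by (simp add: oct_mult_linear scaleR_right_diff_distrib)
  also have "\<dots> = (2 ^ n * (lambda1 ^ i - lambda2 ^ i)) *\<^sub>R R"
    unfolding binet vajda_binet_form prod R_def ..
  also have "\<dots> = (s * s) *\<^sub>R (((2 ^ n * mersenne k i) *\<^sub>R R) /\<^sub>R s)"
    using \<open>s \<noteq> 0\<close> by (simp add: mersenne_binet [OF root1 root2, symmetric] diff mult_ac)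
  finally have "MO (n + i) * MO (n + j) - MO n * MO (n + i + j)
      = ((2 ^ n * mersenne k i) *\<^sub>R R) /\<^sub>R s"
    using \<open>s \<noteq> 0\<close> by (simp only: scaleR_cancel_left mult_eq_0_iff simp_thms)
  then show ?thesis
    by (simp only: MO_def R_def s_def)
qed

end
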